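(* Let $F=(f_1,\dots,f_m):\mathbb{R}^n\to\mathbb{R}^m$ be continuously differentiable, $\sigma\in[0,1)$ and $\beta\in(0,1)$. The sequence $\{x^k\}$ generated by the inexact steepest descent method with Armijo rule is well-defined; that is, whenever an iterate $x^k\in\mathbb{R}^n$ is not a critical Pareto point of $F$, there exists a $\sigma$-approximate steepest descent direction for $F$ at $x^k$, and for every such direction $v^k$ the step length $$t_k:=\max\{2^{-j}: j\in\{0,1,2,\dots\},\ F(x^k+2^{-j}v^k)\preceq F(x^k)+\beta 2^{-j}JF(x^k)v^k\}$$ exists (the set is nonempty), so that $x^{k+1}:=x^k+t_kv^k$ is defined.
   Context: Order: for $x,y\in\mathbb{R}^m$, $x\preceq y$ means $y_i-x_i\ge 0$ for all $i$, and $x\prec y$ means $y_i-x_i>0$ for all $i$. Let $I=\{1,\dots,m\}$; norms and inner products are Euclidean. $JF(x)v=(\langle\nabla f_1(x),v\rangle,\dots,\langle\nabla f_m(x),v\rangle)$. Critical Pareto point: $x\in\mathbb{R}^n$ such that there is no $v\in\mathbb{R}^n$ with $JF(x)v\prec 0$. Set $\alpha(x):=\min_{v\in\mathbb{R}^n}\{\max_{i\in I}\langle\nabla f_i(x),v\rangle+\tfrac12\|v\|^2\}$. For $\sigma\in[0,1)$, a vector $v\in\mathbb{R}^n$ is a $\sigma$-approximate steepest descent direction at $x$ for $F$ if $\max_{i\in I}\langle\nabla f_i(x),v\rangle+\tfrac12\|v\|^2\le(1-\sigma)\alpha(x)$. Inexact steepest descent method with Armijo rule: start from $x^0\in\mathbb{R}^n$;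 for $k=0,1,\dots$, if $x^k$ is a critical Pareto point, stop; otherwise choose a $\sigma$-approximate steepest descent direction $v^k$ at $x^k$, compute $t_k$ by the formula in the claim, and set $x^{k+1}:=x^k+t_kv^k$. *)

theory Defs
  imports "HOL-Analysis.Analysis"
begin

text \<open>
  The library order \<open>\<le>\<close> on \<^typ>\<open>real ^ 'm\<close> is the componentwise one, but the library \<open><\<close> is only
  its irreflexive part; the strict Pareto order requires strictness in every component.
\<close>

definition pareto_less :: "real ^ 'm \<Rightarrow> real ^ 'm \<Rightarrow> bool"  (infix "\<prec>" 50) where
  "x \<prec> y \<longleftrightarrow> (\<forall>i. x $ i < y $ i)"

definition continuously_differentiable ::
    "('a::real_normed_vector \<Rightarrow> 'b::real_normed_vector) \<Rightarrow> bool" where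
  "continuously_differentiable F \<longleftrightarrow>
     (\<exists>F' :: 'a \<Rightarrow> 'a \<Rightarrow>\<^sub>L 'b.
        (\<forall>x. (F has_derivative blinfun_apply (F' x)) (at x)) \<and> continuous_on UNIV F')"

definition grad :: "('a::real_inner \<Rightarrow> real) \<Rightarrow> 'a \<Rightarrow> 'a" where
  "grad f x = (THE D. GDERIV f x :> D)"

definition JF :: "(real ^ 'n \<Rightarrow> real ^ 'm) \<Rightarrow> real ^ 'n \<Rightarrow> real ^ 'n \<Rightarrow> real ^ 'm" where
  "JF F x v = (\<chi> i. grad (\<lambda>y. F y $ i) x \<bullet> v)"

definition critical_pareto :: "(real ^ 'n \<Rightarrow> real ^ 'm) \<Rightarrow> real ^ 'n \<Rightarrow> bool" where
  "critical_pareto F x \<longleftrightarrow> \<not> (\<exists>v. JF F x v \<prec> 0)"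

definition descent_model :: "(real ^ 'n \<Rightarrow> real ^ 'm) \<Rightarrow> real ^ 'n \<Rightarrow> real ^ 'n \<Rightarrow> real" where
  "descent_model F x v = (MAX i. grad (\<lambda>y. F y $ i) x \<bullet> v) + (norm v)\<^sup>2 / 2"

text \<open>
  \<open>LEAST\<close> on the reals is a genuine minimum, unspecified if the minimum is not attained
  (in contrast to \<^const>\<open>Inf\<close>). The same applies to \<open>GREATEST\<close> in the step length below.
\<close>

definition descent_alpha :: "(real ^ 'n \<Rightarrow> real ^ 'm) \<Rightarrow> real ^ 'n \<Rightarrow> real" where
  "descent_alpha F x = (LEAST a. a \<in> range (descent_model F x))"

definition approx_steepest_descent ::
    "real \<Rightarrow> (real ^ 'n \<Rightarrow> real ^ 'm) \<Rightarrow> real ^ 'n \<Rightarrow> real ^ 'n \<Rightarrow> bool" where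
  "approx_steepest_descent \<sigma> F x v \<longleftrightarrow> descent_model F x v \<le> (1 - \<sigma>) * descent_alpha F x"

definition armijo_steps ::
    "real \<Rightarrow> (real ^ 'n \<Rightarrow> real ^ 'm) \<Rightarrow> real ^ 'n \<Rightarrow> real ^ 'n \<Rightarrow> real set" where
  "armijo_steps \<beta> F x v =
     {s. \<exists>j::nat. s = 1 / 2 ^ j \<and> F (x + s *\<^sub>R v) \<le> F x + (\<beta> * s) *\<^sub>R JF F x v}"

definition armijo_step_length ::
    "real \<Rightarrow> (real ^ 'n \<Rightarrow> real ^ 'm) \<Rightarrow> real ^ 'n \<Rightarrow> real ^ 'n \<Rightarrow> real" where
  "armijo_step_length \<beta> F x v = (GREATEST s. s \<in> armijo_steps \<beta> F x v)"

text \<open>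
  \<open>isd_iterate \<sigma> \<beta> F x0 k x\<close>: some run of the method started at \<open>x0\<close> has \<open>x\<close> as its \<open>k\<close>-th
  iterate. The choice of the direction makes this a relation. A step is possible only if the
  maximum that defines the step length exists.
\<close>

inductive isd_iterate ::
    "real \<Rightarrow> real \<Rightarrow> (real ^ 'n \<Rightarrow> real ^ 'm) \<Rightarrow> real ^ 'n \<Rightarrow> nat \<Rightarrow> real ^ 'n \<Rightarrow> bool"
  for \<sigma> \<beta> F x0 where
  start: "isd_iterate \<sigma> \<beta> F x0 0 x0"
| step: "isd_iterate \<sigma> \<beta> F x0 (Suc k) (x + t *\<^sub>R v)"
    if "isd_iterate \<sigma> \<beta> F x0 k x"
      and "\<not> critical_pareto F x"
      and "approx_steepest_descent \<sigma> F x v"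
      and "t \<in> armijo_steps \<beta> F x v"
      and "\<forall>s \<in> armijo_steps \<beta> F x v. s \<le> t"

end

theory Submission
  imports Defs
begin

text \<open>
  The map \<^const>\<open>descent_model\<close> is continuous and coercive, so it has a minimizer, which is a
  \<open>\<sigma>\<close>-approximate steepest descent direction because the minimum is at most the value \<open>0\<close> at the
  origin. At a noncritical point the minimum is negative: scale down a direction along which all
  components decrease. Hence every approximate steepest descent direction has negative directional
  derivatives in all components, and as \<open>\<beta> < 1\<close> the Armijo inequality holds for all small steps.
  Among the admissible powers \<open>1 / 2 ^ j\<close> the one with the least exponent is the largest.
\<close>

section \<open>Gradients of the component functions\<close>

text \<open>Riesz representation in finite dimension: the vector representing the functional
  \<open>f'\<close> is its adjoint applied to \<open>1\<close>.\<close>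

lemma gderiv_exists:
  fixes f :: "'a::euclidean_space \<Rightarrow> real"
  assumes "(f has_derivative f') (at x)"
  shows "\<exists>D. GDERIV f x :> D"
proof -
  have "linear f'"
    using assms has_derivative_linear by blast
  then have "f' h = h \<bullet> adjoint f' 1" for h
    using adjoint_works[of f' h 1] by simp
  then have "f' = (\<lambda>h. h \<bullet> adjoint f' 1)" ..
  then show ?thesis
    using assms unfolding gderiv_def by metis
qed

lemma gderiv_unique:
  assumes "GDERIV f x :> D" and "GDERIV f x :> E"
  shows "D = E"
proof -
  have "(\<lambda>h. h \<bullet> D) = (\<lambda>h. h \<bullet> E)"
    using assms unfolding gderiv_def by (rule has_derivative_unique)
  then show ?thesis
    by (metis vector_eq_ldot)
qed

text \<open>\<open>grad\<close> is a definite description, so it denotes the gradient only once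
  existence and uniqueness are both known.\<close>

lemma gderiv_grad:
  fixes f :: "'a::euclidean_space \<Rightarrow> real"
  assumes "(f has_derivative f') (at x)"
  shows "GDERIV f x :> grad f x"
  unfolding grad_def
  using gderiv_exists[OF assms] gderiv_unique by (blast intro: theI')

lemma gderiv_grad_component:
  fixes F :: "real ^ 'n \<Rightarrow> real ^ 'm"
  assumes "continuously_differentiable F"
  shows "GDERIV (\<lambda>y. F y $ i) x :> grad (\<lambda>y. F y $ i) x"
proof -
  obtain F' where "(F has_derivative F') (at x)"
    using assms unfolding continuously_differentiable_def by blast
  then have "((\<lambda>y. F y $ i) has_derivative (\<lambda>h. F' h $ i)) (at x)"
    by (rule bounded_linear.has_derivative[OF bounded_linear_vec_nth])
  then show ?thesis
    by (rule gderiv_grad)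
qed

section \<open>The descent model: continuity, coercivity, minimizers\<close>

lemma continuous_on_MAX:
  fixes f :: "'i \<Rightarrow> 'a::topological_space \<Rightarrow> 'b::linorder_topology"
  assumes "finite I" and "I \<noteq> {}" and "\<And>i. i \<in> I \<Longrightarrow> continuous_on S (f i)"
  shows "continuous_on S (\<lambda>x. MAX i\<in>I. f i x)"
  using assms
proof (induction I rule: finite_ne_induct)
  case (singleton i)
  then show ?case by simp
next
  case (insert i I)
  then show ?case
    by (auto intro!: continuous_on_max)
qed

lemma continuous_on_descent_model: "continuous_on S (descent_model F x)"
  unfolding descent_model_def
  by (intro continuous_intros continuous_on_MAX) auto

lemma descent_model_0 [simp]: "descent_model F x 0 = 0"
  by (simp add: descent_model_def)

lemma descent_model_less_iff:
  fixes F :: "real ^ 'n \<Rightarrow> real ^ 'm"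
  shows "descent_model F x v < c \<longleftrightarrow> (\<forall>i. JF F x v $ i + (norm v)\<^sup>2 / 2 < c)"
proof -
  have "descent_model F x v < c \<longleftrightarrow> (MAX i. JF F x v $ i) < c - (norm v)\<^sup>2 / 2"
    by (simp add: descent_model_def JF_def less_diff_eq)
  also have "\<dots> \<longleftrightarrow> (\<forall>i. JF F x v $ i < c - (norm v)\<^sup>2 / 2)"
    by (subst Max_less_iff) auto
  finally show ?thesis
    by (simp add: less_diff_eq)
qed

lemma JF_component_le_descent_model:
  "JF F x v $ i + (norm v)\<^sup>2 / 2 \<le> descent_model F x v"
  \<comment> \<open>The bound is chosen as the left-hand side itself: a smaller model value would
    make component \<open>i\<close> strictly less than itself.\<close>
  using descent_model_less_iff[of F x v "JF F x v $ i + (norm v)\<^sup>2 / 2"]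
  by (meson less_irrefl not_le)

text \<open>The maximum dominates every component, so one gradient \<open>g\<close> gives the
  coercivity bound: by Cauchy-Schwarz the model is at least
  \<open>norm v * (norm v / 2 - norm g)\<close>.\<close>

lemma descent_model_nonneg_outside_ball:
  assumes "2 * norm (grad (\<lambda>y. F y $ i) x) \<le> norm v"
  shows "0 \<le> descent_model F x v"
proof -
  let ?g = "grad (\<lambda>y. F y $ i) x"
  have "- (norm ?g * norm v) \<le> ?g \<bullet> v"
    using Cauchy_Schwarz_ineq2[of ?g v] by linarith
  moreover have "2 * norm ?g * norm v \<le> norm v * norm v"
    using assms by (intro mult_right_mono) auto
  ultimately have "0 \<le> JF F x v $ i + (norm v)\<^sup>2 / 2"
    by (simp add: JF_def power2_eq_square)
  then show ?thesis
    using JF_component_le_descent_model order_trans by blast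
qed

lemma descent_model_attains_min:
  fixes F :: "real ^ 'n \<Rightarrow> real ^ 'm"
  shows "\<exists>v. \<forall>w. descent_model F x v \<le> descent_model F x w"
proof -
  \<comment> \<open>Any index serves here; \<open>undefined\<close> just names one. Outside the ball
    of radius \<open>r\<close> the model is at least \<open>0\<close>, its value at the origin, so
    minimizing over the compact ball is enough.\<close>
  define r where "r = 2 * norm (grad (\<lambda>y. F y $ (undefined :: 'm)) x)"
  have "0 \<le> r"
    by (simp add: r_def)
  obtain v where v: "\<forall>w\<in>cball 0 r. descent_model F x v \<le> descent_model F x w"
    using continuous_attains_inf[of "cball 0 r" "descent_model F x"] \<open>0 \<le> r\<close>
      continuous_on_descent_model[of "cball 0 r" F x] by auto
  have "descent_model F x v \<le> descent_model F x w" for w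
  proof (cases "w \<in> cball 0 r")
    case True
    then show ?thesis using v by blast
  next
    case False
    then have "0 \<le> descent_model F x w"
      by (intro descent_model_nonneg_outside_ball[where i = undefined]) (simp add: r_def)
    moreover have "descent_model F x v \<le> 0"
      using v[rule_format, of 0] \<open>0 \<le> r\<close> by simp
    ultimately show ?thesis by simp
  qed
  then show ?thesis by blast
qed

section \<open>The optimal value and approximate steepest descent directions\<close>

lemma descent_alpha_attained: "\<exists>v. descent_alpha F x = descent_model F x v"
  and descent_alpha_le: "descent_alpha F x \<le> descent_model F x w"
proof -
  obtain v where v: "\<And>w. descent_model F x v \<le> descent_model F x w"
    using descent_model_attains_min by blast
  have "descent_alpha F x = descent_model F x v"
    unfolding descent_alpha_def by (rule Least_equality) (auto simp: v)
  then show "\<exists>v. descent_alpha F x = descent_model F x v"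
    and "descent_alpha F x \<le> descent_model F x w"
    using v by auto
qed

lemma approx_steepest_descent_exists:
  assumes "0 \<le> \<sigma>"
  shows "\<exists>v. approx_steepest_descent \<sigma> F x v"
proof -
  obtain v where v: "descent_alpha F x = descent_model F x v"
    using descent_alpha_attained by blast
  have "descent_alpha F x \<le> 0"
    using descent_alpha_le[of F x 0] by simp
  \<comment> \<open>Equivalently, the relaxed bound
    \<open>(1 - \<sigma>) * descent_alpha F x\<close> is no smaller than the minimum itself.\<close>
  then have "\<sigma> * descent_alpha F x \<le> 0"
    using assms by (simp add: mult_nonneg_nonpos)
  then have "approx_steepest_descent \<sigma> F x v"
    unfolding approx_steepest_descent_def v[symmetric] by (simp add: algebra_simps)
  then show ?thesis ..
qed

lemma descent_alpha_neg:
  fixes F :: "real ^ 'n \<Rightarrow> real ^ 'm"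
  assumes "\<not> critical_pareto F x"
  shows "descent_alpha F x < 0"
proof -
  obtain w where w: "\<And>i. JF F x w $ i < 0"
    using assms by (auto simp: critical_pareto_def pareto_less_def)
  \<comment> \<open>This is the component expression of the model at \<open>s *\<^sub>R w\<close>
    divided by \<open>s\<close>: the linear term scales with \<open>s\<close>, the quadratic one
    with its square, so the linear term wins as \<open>s\<close> tends to \<open>0\<close>.\<close>
  have "\<forall>\<^sub>F s in at_right 0. JF F x w $ i + s * (norm w)\<^sup>2 / 2 < 0" for i
  proof -
    have "((\<lambda>s. JF F x w $ i + s * (norm w)\<^sup>2 / 2) \<longlongrightarrow> JF F x w $ i + 0 * (norm w)\<^sup>2 / 2)
        (at_right 0)"
      by (intro tendsto_intros) auto
    then show ?thesis
      using w[of i] by (intro order_tendstoD) auto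
  qed
  then have "\<forall>\<^sub>F s in at_right 0. \<forall>i. JF F x w $ i + s * (norm w)\<^sup>2 / 2 < 0"
    by (rule eventually_all_finite)
  then have "\<forall>\<^sub>F s::real in at_right 0. 0 < s \<and> (\<forall>i. JF F x w $ i + s * (norm w)\<^sup>2 / 2 < 0)"
    using eventually_at_right_less[of "0::real"] by eventually_elim simp
  then obtain s :: real where s: "0 < s" "\<And>i. JF F x w $ i + s * (norm w)\<^sup>2 / 2 < 0"
    by (auto dest: eventually_happens)
  have "JF F x (s *\<^sub>R w) $ i + (norm (s *\<^sub>R w))\<^sup>2 / 2
      = s * (JF F x w $ i + s * (norm w)\<^sup>2 / 2)" for i
    by (simp add: JF_def algebra_simps power2_eq_square)
  then have "descent_model F x (s *\<^sub>R w) < 0"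
    using s by (simp add: descent_model_less_iff mult_pos_neg)
  then show ?thesis
    using descent_alpha_le[of F x "s *\<^sub>R w"] by simp
qed

text \<open>Since \<open>\<sigma> < 1\<close>, the bound on the model value stays strictly negative;
  the quadratic term is nonnegative, so the sign passes to each directional derivative.\<close>

lemma approx_steepest_descent_JF_neg:
  assumes "\<not> critical_pareto F x" and "\<sigma> < 1" and "approx_steepest_descent \<sigma> F x v"
  shows "JF F x v $ i < 0"
proof -
  have "(1 - \<sigma>) * descent_alpha F x < 0"
    using descent_alpha_neg[OF assms(1)] assms(2) by (simp add: mult_pos_neg)
  then have "descent_model F x v < 0"
    using assms(3) by (simp add: approx_steepest_descent_def)
  then show ?thesis
    using JF_component_le_descent_model[of F x v i] zero_le_power2[of "norm v"] by linarith
qed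

section \<open>Existence of Armijo steps\<close>

text \<open>Subtracting the Armijo term from the component along the ray leaves a function of
  \<open>s\<close> with derivative \<open>(1 - \<beta>) * JF F x v $ i\<close> at \<open>0\<close>.
  This is negative, so the function drops below its initial value just to the right of
  \<open>0\<close>.\<close>

lemma armijo_component_eventually:
  fixes F :: "real ^ 'n \<Rightarrow> real ^ 'm"
  assumes "continuously_differentiable F" and "\<beta> < 1" and neg: "JF F x v $ i < 0"
  shows "\<forall>\<^sub>F s in at_right 0. F (x + s *\<^sub>R v) $ i \<le> F x $ i + \<beta> * s * JF F x v $ i"
proof -
  let ?l = "JF F x v $ i"
  \<comment> \<open>The base point is written as the value of the ray at \<open>0\<close>, the form
    the chain rule expects.\<close>
  have "((\<lambda>y. F y $ i) has_derivative (\<lambda>h. h \<bullet> grad (\<lambda>y. F y $ i) x)) (at (x + 0 *\<^sub>R v))"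
    using gderiv_grad_component[OF assms(1), of i x] by (simp add: gderiv_def)
  moreover have "((\<lambda>s. x + s *\<^sub>R v) has_derivative (\<lambda>s. s *\<^sub>R v)) (at (0::real))"
    by (auto intro!: derivative_eq_intros)
  ultimately have "((\<lambda>s. F (x + s *\<^sub>R v) $ i) has_derivative (\<lambda>s. (s *\<^sub>R v) \<bullet> grad (\<lambda>y. F y $ i) x))
      (at 0)"
    by (rule has_derivative_compose[rotated])
  then have "((\<lambda>s. F (x + s *\<^sub>R v) $ i) has_real_derivative ?l) (at 0)"
    by (rule has_derivative_imp_has_field_derivative) (simp add: JF_def inner_commute)
  then have "((\<lambda>s. F (x + s *\<^sub>R v) $ i - \<beta> * s * ?l) has_real_derivative (1 - \<beta>) * ?l) (at 0)"
    by (auto intro!: derivative_eq_intros simp: algebra_simps)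
  moreover have "(1 - \<beta>) * ?l < 0"
    using assms by (simp add: mult_pos_neg)
  ultimately obtain d where "d > 0" and
    d: "\<And>s. 0 < s \<Longrightarrow> s < d \<Longrightarrow> F (x + s *\<^sub>R v) $ i - \<beta> * s * ?l < F x $ i"
    by (auto dest!: DERIV_neg_dec_right)
  then have "F (x + s *\<^sub>R v) $ i \<le> F x $ i + \<beta> * s * ?l" if "0 < s" "s < d" for s
    using d[OF that] by linarith
  then show ?thesis
    using \<open>d > 0\<close> unfolding eventually_at_right_field by blast
qed

lemma armijo_steps_nonempty:
  fixes F :: "real ^ 'n \<Rightarrow> real ^ 'm"
  assumes "continuously_differentiable F" and "\<beta> < 1" and neg: "\<And>i. JF F x v $ i < 0"
  shows "armijo_steps \<beta> F x v \<noteq> {}"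
proof -
  \<comment> \<open>Finitely many components admit a common threshold for \<open>s\<close>.\<close>
  have "\<forall>\<^sub>F s in at_right 0. \<forall>i. F (x + s *\<^sub>R v) $ i \<le> F x $ i + \<beta> * s * JF F x v $ i"
    using assms by (intro eventually_all_finite armijo_component_eventually)
  then have armijo: "\<forall>\<^sub>F s in at_right 0. F (x + s *\<^sub>R v) \<le> F x + (\<beta> * s) *\<^sub>R JF F x v"
    by (simp add: less_eq_vec_def)
  \<comment> \<open>The dyadic steps approach \<open>0\<close> through positive values, so they
    eventually enter the range of good steps.\<close>
  have "filterlim (\<lambda>j. 1 / 2 ^ j :: real) (at_right 0) sequentially"
    using LIMSEQ_inverse_realpow_zero[of 2]
    by (auto intro!: tendsto_imp_filterlim_at_right simp: inverse_eq_divide)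
  with armijo have "\<forall>\<^sub>F j in sequentially.
      F (x + (1 / 2 ^ j) *\<^sub>R v) \<le> F x + (\<beta> * (1 / 2 ^ j)) *\<^sub>R JF F x v"
    by (rule eventually_compose_filterlim)
  then show ?thesis
    unfolding armijo_steps_def eventually_sequentially by blast
qed

text \<open>The set may be infinite and accumulate at \<open>0\<close>; its maximum comes from
  well-ordering of the exponents, since \<open>1 / 2 ^ j\<close> decreases in
  \<open>j\<close>.\<close>

lemma armijo_step_length_greatest:
  assumes "armijo_steps \<beta> F x v \<noteq> {}"
  shows "armijo_step_length \<beta> F x v \<in> armijo_steps \<beta> F x v"
    and "\<forall>s \<in> armijo_steps \<beta> F x v. s \<le> armijo_step_length \<beta> F x v"
proof -
  let ?P = "\<lambda>j::nat. 1 / 2 ^ j \<in> armijo_steps \<beta> F x v"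
  have ex: "\<exists>j. ?P j"
    using assms by (auto simp: armijo_steps_def)
  define t :: real where "t = 1 / 2 ^ (LEAST j. ?P j)"
  have t: "t \<in> armijo_steps \<beta> F x v"
    using LeastI_ex[OF ex] by (simp add: t_def)
  have max: "s \<le> t" if s: "s \<in> armijo_steps \<beta> F x v" for s
  proof -
    obtain j where j: "s = 1 / 2 ^ j"
      using s by (auto simp: armijo_steps_def)
    then have "(LEAST j. ?P j) \<le> j"
      using s by (intro Least_le) simp
    then show ?thesis
      by (simp add: j t_def field_simps)
  qed
  have "armijo_step_length \<beta> F x v = t"
    unfolding armijo_step_length_def using t max by (intro Greatest_equality)
  then show "armijo_step_length \<beta> F x v \<in> armijo_steps \<beta> F x v"
    and "\<forall>s \<in> armijo_steps \<beta> F x v. s \<le> armijo_step_length \<beta> F x v"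
    using t max by auto
qed

theorem proposition4p2:
  fixes F :: "real ^ 'n \<Rightarrow> real ^ 'm" and \<sigma> \<beta> :: real
    and x0 xk :: "real ^ 'n" and k :: nat
  assumes "continuously_differentiable F"
    and "0 \<le> \<sigma>" and "\<sigma> < 1"
    and "0 < \<beta>" and "\<beta> < 1"
    and "isd_iterate \<sigma> \<beta> F x0 k xk"
    and "\<not> critical_pareto F xk"
  shows "(\<exists>v. approx_steepest_descent \<sigma> F xk v) \<and>
    (\<forall>v. approx_steepest_descent \<sigma> F xk v \<longrightarrow>
       armijo_steps \<beta> F xk v \<noteq> {} \<and>
       armijo_step_length \<beta> F xk v \<in> armijo_steps \<beta> F xk v \<and>
       (\<forall>s \<in> armijo_steps \<beta> F xk v. s \<le> armijo_step_length \<beta> F xk v) \<and>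
       isd_iterate \<sigma> \<beta> F x0 (Suc k) (xk + armijo_step_length \<beta> F xk v *\<^sub>R v))"
proof (intro conjI allI impI)
  show "\<exists>v. approx_steepest_descent \<sigma> F xk v"
    using assms(2) by (rule approx_steepest_descent_exists)
next
  fix v
  assume v: "approx_steepest_descent \<sigma> F xk v"
  show nonempty: "armijo_steps \<beta> F xk v \<noteq> {}"
    using assms(1,5) approx_steepest_descent_JF_neg[OF assms(7,3) v]
    by (rule armijo_steps_nonempty)
  note greatest = armijo_step_length_greatest[OF nonempty]
  show "armijo_step_length \<beta> F xk v \<in> armijo_steps \<beta> F xk v"
    and "\<forall>s \<in> armijo_steps \<beta> F xk v. s \<le> armijo_step_length \<beta> F xk v"
    by (fact greatest)+
  \<comment> \<open>The two facts in \<open>greatest\<close> are exactly the step-length premises of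
    \<open>isd_iterate.step\<close>.\<close>
  show "isd_iterate \<sigma> \<beta> F x0 (Suc k) (xk + armijo_step_length \<beta> F xk v *\<^sub>R v)"
    using assms(6,7) v greatest by (rule isd_iterate.step)
qed

end
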